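(* Let $D\ge1$, $\alpha>0$, $a_\delta>0$, $b_\delta>0$ and $\sigma_{\mathbf y}^2>0$ be fixed. Let $(\mathbf y_n)_{n\ge1}$ be independent and identically distributed $D$-dimensional random vectors with distribution $\mathcal N(0,\sigma_{\mathbf y}^2\,\mathbb I_D)$ and let $\mathbf Y_N=[\mathbf y_1,\dots,\mathbf y_N]$. Let $K_N$ be the latent subspace dimension in the Bayesian model described in the context, and let $\mathrm P(K_N=0\mid\mathbf Y_N,\alpha,\sigma_{\mathbf y}^2)$ be the posterior probability that $K_N=0$ given $\mathbf Y_N$, with the parameter $\alpha$ fixed and the noise variance of the model fixed to $\sigma^2=\sigma_{\mathbf y}^2$. Then $$\mathrm P\big(K_N=0\mid\mathbf Y_N,\alpha,\sigma_{\mathbf y}^2\big)\ \xrightarrow[N\to+\infty]{\text{a.s.}}\ 0 .$$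
   Context: Model (BNP-PCA) with known noise variance $\sigma^2$. For $n=1,\dots,N$, $\mathbf y_n=\mathbf P(\mathbf z_n\odot \mathbf x_n)+\mathbf e_n\in\mathbb R^D$, where $\odot$ is the entrywise product, and: - The noise vectors $\mathbf e_n$ are i.i.d. $\mathcal N(0,\sigma^2\mathbb I_D)$. - $\mathbf P=[\mathbf p_1,\dots,\mathbf p_D]$ is a $D\times D$ orthogonal matrix with prior the uniform (Haar) probability distribution on the orthogonal group $\mathcal O_D$. - $\mathbf Z=(z_{k,n})$ is a binary matrix with $N$ columns and a random number $K\in\{0,1,\dots,D\}$ of rows, each row being nonzero, considered up to permutation of its rows; $\mathbf z_n$ is the $n$-th column of $\mathbf Z$, extended by $z_{k,n}=0$ for $K<k\le D$. The prior on $\mathbf Z$ is the Indian buffet process with parameter $\alpha$, $$\mathrm P[\mathbf Z\mid\alpha]=\frac{\alpha^{K}e^{-\alpha\sum_{n=1}^N 1/n}}{\prod_{i=1}^{2^N-1}K_i!}\prod_{k=1}^{K}\frac{(N-m_k)!\,(m_k-1)!}{N!},$$ where $m_k=\sum_{n}z_{k,n}$, and $K_i$ is the number of rows of $\mathbf Z$ equal to the $i$-th nonzero binary vector ("history") in $\{0,1\}^N$. Matrices with $K>D$ rows are given probability $0$ (because of the orthogonality of $\mathbf P$). - Given $\sigma^2$ and scale parameters $\delta_1^2,\delta_2^2,\dots$, the coefficients $x_{k,n}$ are independent with $x_{k,n}\sim\mathcal N(0,\delta_k^2\sigma^2)$. - The $\delta_k^2$ are i.i.d. with the shifted inverse gamma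 density on $(0,\infty)$: $\displaystyle \frac{b_\delta^{a_\delta}}{\gamma(a_\delta,b_\delta)}\Big(\frac1{1+t}\Big)^{a_\delta+1}\exp\Big(-\frac{b_\delta}{1+t}\Big)$, where $\gamma(a,b)=\int_0^b t^{a-1}e^{-t}\,dt$ is the lower incomplete gamma function. The marginal likelihood $\mathrm p(\mathbf Y_N\mid \mathbf Z,\sigma^2)$ is obtained by integrating the Gaussian likelihood of $\mathbf Y_N$ over the priors of $\mathbf X=(x_{k,n})$, $\mathbf P$ and $(\delta_k^2)_{k\le K}$. The latent dimension $K_N$ is the number $K$ of rows of $\mathbf Z$, and $$\mathrm P(K_N=k\mid \mathbf Y_N,\alpha,\sigma^2)=\frac{\sum_{\mathbf Z:\,K=k}\mathrm P[\mathbf Z\mid\alpha]\,\mathrm p(\mathbf Y_N\mid\mathbf Z,\sigma^2)}{\sum_{k'=0}^{D}\sum_{\mathbf Z:\,K=k'}\mathrm P[\mathbf Z\mid\alpha]\,\mathrm p(\mathbf Y_N\mid\mathbf Z,\sigma^2)},$$ the sums being over binary matrices up to row permutation. *)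

theory Defs
  imports "HOL-Probability.Probability"
begin

text \<open>Density of \<open>N(\<mu>, s2 I)\<close>; \<open>s2\<close> is the variance, whereas
  \<^const>\<open>normal_density\<close> expects the standard deviation.\<close>

definition gauss_density :: "real^'d::finite \<Rightarrow> real \<Rightarrow> real^'d \<Rightarrow> real" where
  "gauss_density \<mu> s2 v = (\<Prod>i\<in>UNIV. normal_density (\<mu> $ i) (sqrt s2) (v $ i))"

text \<open>The Haar (uniform) probability distribution on the orthogonal group, regarded as a Borel
  measure on all matrices that is carried by the orthogonal ones. Left invariance determines it.\<close>

definition haar_orthogonal :: "(real^'d::finite^'d) measure \<Rightarrow> bool" where
  "haar_orthogonal H \<longleftrightarrow>
     prob_space H \<and> sets H = sets borel \<and> (AE P in H. orthogonal_matrix P) \<and>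
     (\<forall>Q. orthogonal_matrix Q \<longrightarrow> distr H borel (\<lambda>P. Q ** P) = H)"

definition lower_inc_gamma :: "real \<Rightarrow> real \<Rightarrow> real" where
  "lower_inc_gamma a b = (LBINT t:{0<..b}. t powr (a - 1) * exp (- t))"

definition shifted_inv_gamma_density :: "real \<Rightarrow> real \<Rightarrow> real \<Rightarrow> real" where
  "shifted_inv_gamma_density a b t =
     (if 0 < t
      then b powr a / lower_inc_gamma a b * (1 / (1 + t)) powr (a + 1) * exp (- b / (1 + t))
      else 0)"

text \<open>A row (history) of a binary matrix with columns \<open>1, \<dots>, N\<close> is encoded by its support, so the
  nonzero histories are the nonempty subsets of \<open>{1..N}\<close>. A binary matrix up to permutation of its
  rows is the multiset of its rows; its number of rows is the size of the multiset.\<close>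

definition histories :: "nat \<Rightarrow> nat set set" where
  "histories N = Pow {1..N} - {{}}"

definition binary_matrices :: "nat \<Rightarrow> nat \<Rightarrow> nat set multiset set" where
  "binary_matrices N k = {Z. size Z = k \<and> set_mset Z \<subseteq> histories N}"

lemma finite_binary_matrices: "finite (binary_matrices N k)"
proof -
  have "binary_matrices N k \<subseteq> mset ` {xs. set xs \<subseteq> histories N \<and> length xs = k}"
  proof
    fix Z assume Z: "Z \<in> binary_matrices N k"
    obtain xs where "mset xs = Z" using ex_mset by blast
    with Z show "Z \<in> mset ` {xs. set xs \<subseteq> histories N \<and> length xs = k}"
      by (auto simp: binary_matrices_def)
  qed
  moreover have "finite (histories N)" by (simp add: histories_def)
  then have "finite (mset ` {xs. set xs \<subseteq> histories N \<and> length xs = k})"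
    by (intro finite_imageI finite_lists_length_eq)
  ultimately show ?thesis by (rule finite_subset)
qed

text \<open>Indian buffet process prior, set to 0 beyond \<open>D\<close> rows without renormalisation (a constant
  factor cancels in the posterior). The product over the rows counts multiplicities.\<close>

definition ibp_prior :: "nat \<Rightarrow> real \<Rightarrow> nat \<Rightarrow> nat set multiset \<Rightarrow> real" where
  "ibp_prior D \<alpha> N Z =
     (if size Z \<le> D
      then \<alpha> ^ size Z * exp (- \<alpha> * (\<Sum>n=1..N. 1 / real n))
             / (\<Prod>h\<in>histories N. fact (count Z h))
             * (\<Prod>h\<in>#Z. fact (N - card h) * fact (card h - 1) / fact N)
      else 0)"

text \<open>Below, a matrix representing a class is a list of rows, and rows are numbered from 0. The
  library bijection \<open>to_nat_on UNIV\<close> from \<open>'d\<close> to \<open>{..<CARD('d)}\<close> numbers the columns of \<open>P\<close>.\<close>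

definition binary_entry :: "nat set list \<Rightarrow> nat \<Rightarrow> nat \<Rightarrow> real" where
  "binary_entry zs k n = (if k < length zs \<and> n \<in> zs ! k then 1 else 0)"

definition latent_mean ::
    "real^'d::finite^'d \<Rightarrow> nat set list \<Rightarrow> (nat \<times> nat \<Rightarrow> real) \<Rightarrow> nat \<Rightarrow> real^'d" where
  "latent_mean P zs X n =
     P *v (\<chi> j. let k = to_nat_on (UNIV :: 'd set) j in binary_entry zs k n * X (k, n))"

definition scale_prior :: "real \<Rightarrow> real \<Rightarrow> nat \<Rightarrow> (nat \<Rightarrow> real) measure" where
  "scale_prior a b K =
     PiM {..<K} (\<lambda>_. density lborel (\<lambda>t. ennreal (shifted_inv_gamma_density a b t)))"

text \<open>The argument \<open>\<delta>2\<close> gives the squared scale parameters.\<close>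

definition coeff_prior ::
    "real \<Rightarrow> (nat \<Rightarrow> real) \<Rightarrow> nat \<Rightarrow> nat \<Rightarrow> (nat \<times> nat \<Rightarrow> real) measure" where
  "coeff_prior s2 \<delta>2 K N =
     PiM ({..<K} \<times> {1..N})
       (\<lambda>(k, n). density lborel (\<lambda>x. ennreal (normal_density 0 (sqrt (\<delta>2 k * s2)) x)))"

definition marginal_likelihood_rows ::
    "(real^'d::finite^'d) measure \<Rightarrow> real \<Rightarrow> real \<Rightarrow> real \<Rightarrow> nat \<Rightarrow> (nat \<Rightarrow> real^'d)
      \<Rightarrow> nat set list \<Rightarrow> real" where
  "marginal_likelihood_rows H a b s2 N Y zs =
     (\<integral>P. (\<integral>\<delta>2. (\<integral>X. (\<Prod>n=1..N. gauss_density (latent_mean P zs X n) s2 (Y n))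
        \<partial>coeff_prior s2 \<delta>2 (length zs) N) \<partial>scale_prior a b (length zs)) \<partial>H)"

text \<open>The choice of the representative is immaterial: the scales and coefficients are exchangeable
  in \<open>k\<close>, and Haar measure is invariant under permutation of the columns.\<close>

definition marginal_likelihood ::
    "(real^'d::finite^'d) measure \<Rightarrow> real \<Rightarrow> real \<Rightarrow> real \<Rightarrow> nat \<Rightarrow> (nat \<Rightarrow> real^'d)
      \<Rightarrow> nat set multiset \<Rightarrow> real" where
  "marginal_likelihood H a b s2 N Y Z =
     marginal_likelihood_rows H a b s2 N Y (SOME zs. mset zs = Z)"

definition joint_weight ::
    "(real^'d::finite^'d) measure \<Rightarrow> real \<Rightarrow> real \<Rightarrow> real \<Rightarrow> real \<Rightarrow> nat \<Rightarrow> (nat \<Rightarrow> real^'d)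
      \<Rightarrow> nat \<Rightarrow> real" where
  "joint_weight H a b \<alpha> s2 N Y k =
     (\<Sum>Z\<in>binary_matrices N k. ibp_prior CARD('d) \<alpha> N Z * marginal_likelihood H a b s2 N Y Z)"

definition posterior_dim ::
    "(real^'d::finite^'d) measure \<Rightarrow> real \<Rightarrow> real \<Rightarrow> real \<Rightarrow> real \<Rightarrow> nat \<Rightarrow> (nat \<Rightarrow> real^'d)
      \<Rightarrow> nat \<Rightarrow> real" where
  "posterior_dim H a b \<alpha> s2 N Y k =
     joint_weight H a b \<alpha> s2 N Y k / (\<Sum>k'=0..CARD('d). joint_weight H a b \<alpha> s2 N Y k')"

end

theory Submission
  imports Defs
begin

text \<open>It suffices to compare the models with \<open>K = 1\<close> and \<open>K = 0\<close>. With \<open>f\<^sub>n(q)\<close> the likelihood ratio of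
  column \<open>n\<close> at the parameter \<open>q = (P, \<delta>\<^sup>2)\<close>, the ratio of their weights is
  \<open>\<alpha> \<Sum>\<^sub>m 1/m \<integral> e\<^sub>m(f\<^sub>1(q), \<dots>, f\<^sub>N(q)) / (N choose m) dq\<close>, where \<open>e\<^sub>m\<close> is the elementary symmetric
  polynomial. Since \<open>f\<^sub>n\<close> has mean one when the data are pure noise, the law of large numbers makes each
  normalised \<open>e\<^sub>m\<close> asymptotically at least about 1, so the weight ratio exceeds any multiple
  of a partial harmonic sum. The law of large numbers is applied to the \<open>q\<close>-average of the capped
  ratio \<open>min f\<^sub>n B\<close>, which is bounded, so Hoeffding's inequality suffices. No total mass of
  the scale prior needs to be computed, only its positivity and finiteness.\<close>

section \<open>Elementary symmetric polynomials of bounded nonnegative numbers\<close>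

text \<open>Double counting: removing the marked element \<open>n\<close> is a bijection from
  (m+1)-subsets with a marked member to m-subsets with a marked outsider. It drives the recursion
  from one elementary symmetric polynomial to the next.\<close>

lemma sum_insert_subsets:
  fixes g :: "'a set \<Rightarrow> 'a \<Rightarrow> 'b::comm_monoid_add"
  assumes "finite A"
  shows "(\<Sum>h | h \<subseteq> A \<and> card h = Suc m. \<Sum>n\<in>h. g (h - {n}) n)
       = (\<Sum>h | h \<subseteq> A \<and> card h = m. \<Sum>n\<in>A - h. g h n)"
proof -
  have fin: "finite {h. h \<subseteq> A \<and> card h = k}" for k
    using assms by (rule_tac finite_subset[of _ "Pow A"]) auto
  have fin': "finite h" if "h \<subseteq> A" for h
    using assms that by (rule rev_finite_subset)
  have "(\<Sum>h | h \<subseteq> A \<and> card h = Suc m. \<Sum>n\<in>h. g (h - {n}) n)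
      = (\<Sum>(h, n)\<in>Sigma {h. h \<subseteq> A \<and> card h = Suc m} (\<lambda>h. h). g (h - {n}) n)"
    by (rule sum.Sigma) (use fin fin' in auto)
  also have "\<dots> = (\<Sum>(h, n)\<in>Sigma {h. h \<subseteq> A \<and> card h = m} (\<lambda>h. A - h). g h n)"
    by (rule sum.reindex_bij_witness[where i = "\<lambda>(h, n). (insert n h, n)"
          and j = "\<lambda>(h, n). (h - {n}, n)"])
       (auto simp: insert_absorb card_insert_if fin')
  also have "\<dots> = (\<Sum>h | h \<subseteq> A \<and> card h = m. \<Sum>n\<in>A - h. g h n)"
    by (rule sum.Sigma[symmetric]) (use fin assms in auto)
  finally show ?thesis .
qed

text \<open>\<open>fact m\<close> times the elementary symmetric polynomial sums over ordered
  choices of m distinct indices. The indices already chosen use up at most B each, so every further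
  choice still has at least the total minus \<open>m * B\<close> available. Truncation at 0 keeps
  the powers monotone.\<close>

lemma fact_mult_elementary_symmetric_ge:
  fixes f :: "'a \<Rightarrow> real"
  assumes "finite A" and f: "\<And>n. n \<in> A \<Longrightarrow> 0 \<le> f n" "\<And>n. n \<in> A \<Longrightarrow> f n \<le> B" and "0 \<le> B"
  shows "max 0 (sum f A - m * B) ^ m \<le> fact m * (\<Sum>h | h \<subseteq> A \<and> card h = m. prod f h)"
proof (induction m)
  case 0
  have "{h. h \<subseteq> A \<and> card h = 0} = {{}}"
    using assms(1) by (auto dest: finite_subset)
  then show ?case by simp
next
  case (Suc m)
  \<comment> \<open>This base lies below the one in the induction hypothesis and below every sum
    over the complement of an m-subset, so one factor \<open>s\<close> can be traded for such a
    sum.\<close>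
  define s where "s = max 0 (sum f A - Suc m * B)"
  have fin': "finite h" if "h \<subseteq> A" for h
    using assms(1) that by (rule rev_finite_subset)
  have s: "s \<le> (\<Sum>n\<in>A - h. f n)" if "h \<subseteq> A" "card h = m" for h
  proof -
    have "sum f h \<le> m * B"
      using sum_bounded_above[of h f B] f(2) that by auto
    moreover have "sum f (A - h) = sum f A - sum f h"
      using that assms(1) by (simp add: sum_diff)
    moreover have "0 \<le> sum f (A - h)" by (rule sum_nonneg) (use f in auto)
    ultimately show ?thesis using \<open>0 \<le> B\<close> by (auto simp: s_def algebra_simps)
  qed
  have "s ^ Suc m \<le> max 0 (sum f A - m * B) ^ m * s"
    using \<open>0 \<le> B\<close> by (auto simp: s_def algebra_simps intro!: mult_left_mono power_mono)
  also have "\<dots> \<le> fact m * (\<Sum>h | h \<subseteq> A \<and> card h = m. prod f h) * s"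
    by (rule mult_right_mono[OF Suc.IH]) (simp add: s_def)
  also have "\<dots> = fact m * (\<Sum>h | h \<subseteq> A \<and> card h = m. prod f h * s)"
    by (simp add: sum_distrib_right)
  also have "\<dots> \<le> fact m * (\<Sum>h | h \<subseteq> A \<and> card h = m. \<Sum>n\<in>A - h. prod f h * f n)"
    using s f(1) by (intro mult_left_mono sum_mono)
      (auto simp: sum_distrib_left[symmetric] intro!: mult_left_mono prod_nonneg)
  also have "\<dots> = fact m * (\<Sum>h | h \<subseteq> A \<and> card h = Suc m. \<Sum>n\<in>h. prod f (h - {n}) * f n)"
    by (subst sum_insert_subsets[OF assms(1), where g = "\<lambda>h n. prod f h * f n"]) simp
  also have "\<dots> = fact m * (\<Sum>h | h \<subseteq> A \<and> card h = Suc m. \<Sum>n\<in>h. prod f h)"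
    by (intro arg_cong2[where f = "(*)"] refl sum.cong)
       (auto simp: prod.remove[OF fin'] mult.commute)
  also have "\<dots> = fact (Suc m) * (\<Sum>h | h \<subseteq> A \<and> card h = Suc m. prod f h)"
    by (simp add: sum_distrib_left mult_ac)
  finally show ?case by (simp add: s_def)
qed

text \<open>Since \<open>(N choose m) * fact m\<close> is at most \<open>N ^ m\<close>, the
  normalised polynomial dominates the m-th power of \<open>s / N\<close>, which lies above its
  tangent line at 1.\<close>

lemma elementary_symmetric_mean_ge:
  fixes f :: "'a \<Rightarrow> real"
  assumes "finite A" and f: "\<And>n. n \<in> A \<Longrightarrow> 0 \<le> f n" "\<And>n. n \<in> A \<Longrightarrow> f n \<le> B" and "0 \<le> B"
    and m: "1 \<le> m" "m \<le> card A"
  shows "1 + m * ((sum f A - m * B) / card A - 1)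
       \<le> (\<Sum>h | h \<subseteq> A \<and> card h = m. prod f h) / (card A choose m)"
proof -
  let ?N = "real (card A)" and ?e = "\<Sum>h | h \<subseteq> A \<and> card h = m. prod f h"
  define s where "s = max 0 (sum f A - m * B)"
  have N: "0 < ?N" using m by simp
  have C: "0 < real (card A choose m)" using m by simp
  have "(card A choose m) * fact m \<le> card A ^ m" by (rule binomial_fact_pow)
  then have pow: "real (card A choose m) * fact m \<le> ?N ^ m"
    by (metis of_nat_fact of_nat_le_iff of_nat_mult of_nat_power)
  have "1 + m * ((sum f A - m * B) / ?N - 1) \<le> 1 + m * (s / ?N - 1)"
    using N m by (intro add_left_mono mult_left_mono diff_right_mono divide_right_mono) (auto simp: s_def)
  \<comment> \<open>Bernoulli's inequality requires the increment to be at least -1, which is the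
    purpose of truncating \<open>s\<close> at 0.\<close>
  also have "\<dots> \<le> (1 + (s / ?N - 1)) ^ m"
    by (rule Bernoulli_inequality) (simp add: s_def)
  also have "\<dots> = s ^ m / ?N ^ m" by (simp add: power_divide)
  also have "\<dots> \<le> s ^ m / (real (card A choose m) * fact m)"
    using pow C N by (intro divide_left_mono) (auto simp: s_def)
  also have "\<dots> \<le> fact m * ?e / (real (card A choose m) * fact m)"
    using fact_mult_elementary_symmetric_ge[OF assms(1-4), where m = m] C
    by (intro divide_right_mono) (auto simp: s_def)
  also have "\<dots> = ?e / (card A choose m)" by simp
  finally show ?thesis .
qed

section \<open>Strong law of large numbers for bounded variables\<close>

text \<open>Hoeffding's inequality makes the probabilities of a fixed deviation summable, and
  Borel-Cantelli leaves only finitely many deviations almost surely.\<close>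

lemma (in prob_space) strong_law_bounded:
  fixes X :: "nat \<Rightarrow> 'a \<Rightarrow> real"
  assumes indep: "indep_vars (\<lambda>_. borel) X {1..}"
    and bnd: "\<And>n \<omega>. 1 \<le> n \<Longrightarrow> X n \<omega> \<in> {0..B}" and "0 < B"
    and mean: "\<And>n. 1 \<le> n \<Longrightarrow> expectation (X n) = \<mu>"
  shows "AE \<omega> in M. (\<lambda>N. (\<Sum>n=1..N. X n \<omega>) / N) \<longlonglongrightarrow> \<mu>"
proof -
  have meas [measurable]: "X n \<in> borel_measurable M" if "1 \<le> n" for n
    using indep that by (auto simp: indep_vars_def)
  have "AE \<omega> in M. eventually (\<lambda>N. \<bar>(\<Sum>n=1..N. X n \<omega>) / N - \<mu>\<bar> < \<epsilon>) sequentially"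
    if "0 < \<epsilon>" for \<epsilon>
  proof -
    \<comment> \<open>The sample size \<open>Suc N\<close> keeps the index set nonempty, so the sum
      of squared ranges in Hoeffding's bound is positive. The shift is undone by
      \<open>eventually_sequentially_Suc\<close>.\<close>
    define A where "A N = {\<omega> \<in> space M. \<bar>(\<Sum>n=1..Suc N. X n \<omega>) - Suc N * \<mu>\<bar> \<ge> Suc N * \<epsilon>}" for N
    have A [measurable]: "A N \<in> sets M" for N
      unfolding A_def by measurable
    have A_le: "prob (A N) \<le> 2 * exp (-2 * \<epsilon>\<^sup>2 / B\<^sup>2) ^ Suc N" for N
    proof -
      interpret Hoeffding_ineq M "{1..Suc N}" X "\<lambda>_. 0" "\<lambda>_. B" "Suc N * \<mu>"
      proof unfold_locales
        show "indep_vars (\<lambda>_. borel) X {1..Suc N}"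
          by (rule indep_vars_subset[OF indep]) auto
        show "Suc N * \<mu> \<equiv> (\<Sum>i = 1..Suc N. expectation (X i))"
          using mean by (intro eq_reflection) simp
      qed (use bnd in auto)
      have "prob (A N) \<le> 2 * exp (-2 * (Suc N * \<epsilon>)\<^sup>2 / (\<Sum>i=1..Suc N. (B - 0)\<^sup>2))"
        unfolding A_def using \<open>0 < \<epsilon>\<close> \<open>0 < B\<close> by (intro Hoeffding_ineq_abs_ge) auto
      \<comment> \<open>The exponent is linear in the sample size, so the tail bounds form a
        geometric series.\<close>
      also have "-2 * (Suc N * \<epsilon>)\<^sup>2 / (\<Sum>i=1..Suc N. (B - 0)\<^sup>2) = Suc N * (-2 * \<epsilon>\<^sup>2 / B\<^sup>2)"
      proof -
        have "-2 * (r * \<epsilon>)\<^sup>2 / (r * B\<^sup>2) = r * (-2 * \<epsilon>\<^sup>2 / B\<^sup>2)" if "0 < r" for r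
          using that by (simp add: power2_eq_square)
        from this[of "real (Suc N)"] show ?thesis by simp
      qed
      finally show ?thesis by (simp only: exp_of_nat_mult)
    qed
    have "summable (\<lambda>N. 2 * exp (-2 * \<epsilon>\<^sup>2 / B\<^sup>2) ^ Suc N)"
      using \<open>0 < \<epsilon>\<close> \<open>0 < B\<close> by (subst summable_Suc_iff) (auto intro!: summable_mult summable_geometric)
    then have "summable (\<lambda>N. prob (A N))"
      by (rule summable_comparison_test') (use A_le in auto)
    then have "AE \<omega> in M. eventually (\<lambda>N. \<omega> \<in> space M - A N) sequentially"
      by (intro borel_cantelli_AE1) (auto simp: emeasure_eq_measure)
    then show ?thesis
    proof eventually_elim
      case (elim \<omega>)
      then have "eventually (\<lambda>N. \<bar>(\<Sum>n=1..Suc N. X n \<omega>) / Suc N - \<mu>\<bar> < \<epsilon>) sequentially"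
      proof eventually_elim
        case (elim N)
        then have "\<bar>(\<Sum>n=1..Suc N. X n \<omega>) - Suc N * \<mu>\<bar> < Suc N * \<epsilon>"
          by (auto simp: A_def)
        moreover have "(\<Sum>n=1..Suc N. X n \<omega>) / Suc N - \<mu> = ((\<Sum>n=1..Suc N. X n \<omega>) - Suc N * \<mu>) / Suc N"
          by (simp add: field_simps del: sum.cl_ivl_Suc)
        ultimately show ?case
          by (simp add: abs_divide pos_divide_less_eq mult.commute del: sum.cl_ivl_Suc of_nat_Suc)
      qed
      then show ?case by (subst (asm) eventually_sequentially_Suc)
    qed
  qed
  \<comment> \<open>Countably many tolerances suffice for convergence and share one null
    set.\<close>
  then have "AE \<omega> in M. \<forall>k. eventually (\<lambda>N. \<bar>(\<Sum>n=1..N. X n \<omega>) / N - \<mu>\<bar> < inverse (real (Suc k))) sequentially"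
    by (subst AE_all_countable) auto
  then show ?thesis
  proof eventually_elim
    case (elim \<omega>)
    show ?case
    proof (rule tendstoI)
      fix e :: real assume "0 < e"
      then obtain k where "inverse (real (Suc k)) < e" using reals_Archimedean by blast
      with elim[rule_format, of k]
      show "eventually (\<lambda>N. dist ((\<Sum>n=1..N. X n \<omega>) / N) \<mu> < e) sequentially"
        by (auto simp: dist_real_def elim!: eventually_mono)
    qed
  qed
qed

section \<open>The scale prior as a finite nonzero measure\<close>

text \<open>Integrability must come first, because the Bochner integral of a non-integrable function
  is 0; it is inherited from Euler's Gamma integral. A zero integral would then make a positive
  integrand vanish almost everywhere on an interval of length b.\<close>

lemma lower_inc_gamma_pos:
  assumes "0 < a" "0 < b"
  shows "0 < lower_inc_gamma a b"
proof -
  let ?f = "\<lambda>t::real. t powr (a - 1) * exp (- t)"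
  have "(\<lambda>t::real. t powr (a - 1) / exp t) absolutely_integrable_on {0..}"
    using Gamma_integral_real[OF assms(1)]
    by (intro nonnegative_absolutely_integrable_1) (auto intro: has_integral_integrable)
  then have "set_integrable lborel {0..} ?f"
    unfolding set_integrable_def by (subst (asm) integrable_completion) (auto simp: exp_minus field_simps)
  then have int: "set_integrable lborel {0<..b} ?f"
    by (rule set_integrable_subset) auto
  have "lower_inc_gamma a b \<noteq> 0"
  proof
    assume "lower_inc_gamma a b = 0"
    then have "AE t in lborel. indicator {0<..b} t *\<^sub>R ?f t = 0"
      using integral_nonneg_eq_0_iff_AE[of lborel "\<lambda>t. indicator {0<..b} t *\<^sub>R ?f t"] int
      by (auto simp: lower_inc_gamma_def set_lebesgue_integral_def set_integrable_def)
    then have "AE t in lborel. t \<notin> {0<..b}"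
      by eventually_elim (auto simp: indicator_def split: if_splits)
    then have "emeasure lborel {0<..b} = 0"
      by (subst (asm) AE_iff_measurable[where N = "{0<..b}"]) auto
    then show False using assms by simp
  qed
  moreover have "0 \<le> lower_inc_gamma a b"
    unfolding lower_inc_gamma_def set_lebesgue_integral_def by (rule integral_nonneg_AE) auto
  ultimately show ?thesis by simp
qed

lemma shifted_inv_gamma_density_pos:
  assumes "0 < a" "0 < b" "0 < t"
  shows "0 < shifted_inv_gamma_density a b t"
  using lower_inc_gamma_pos[of a b] assms by (simp add: shifted_inv_gamma_density_def)

lemma borel_measurable_shifted_inv_gamma_density [measurable]:
  "shifted_inv_gamma_density a b \<in> borel_measurable borel"
  unfolding shifted_inv_gamma_density_def[abs_def] by measurable

definition scale_law :: "real \<Rightarrow> real \<Rightarrow> real measure" where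
  "scale_law a b = density lborel (\<lambda>t. ennreal (shifted_inv_gamma_density a b t))"

lemma sets_scale_law [simp, measurable_cong]: "sets (scale_law a b) = sets borel"
  by (simp add: scale_law_def)

lemma space_scale_law [simp]: "space (scale_law a b) = UNIV"
  by (simp add: scale_law_def)

text \<open>The exponential factor is at most 1, so the density is dominated by a multiple of
  \<open>(1 + t) powr (- a - 1)\<close>, whose antiderivative \<open>?F\<close> vanishes at
  infinity.\<close>

lemma finite_measure_scale_law:
  assumes "0 < a" "0 < b"
  shows "finite_measure (scale_law a b)"
proof (rule finite_measureI)
  define c where "c = b powr a / lower_inc_gamma a b"
  have c: "0 \<le> c" using lower_inc_gamma_pos[OF assms] by (simp add: c_def)
  let ?F = "\<lambda>t::real. - (c / a) * (1 + t) powr (- a)"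
  have "emeasure (scale_law a b) UNIV = (\<integral>\<^sup>+ t. ennreal (shifted_inv_gamma_density a b t) \<partial>lborel)"
    unfolding scale_law_def by (subst emeasure_density) (auto simp del: space_lborel)
  also have "\<dots> \<le> (\<integral>\<^sup>+ t. ennreal (c * (1 + t) powr (- a - 1)) * indicator {0..} t \<partial>lborel)"
  proof (rule nn_integral_mono)
    fix t :: real
    have "shifted_inv_gamma_density a b t \<le> c * (1 + t) powr (- a - 1)" if "0 < t"
    proof -
      have "(1 / (1 + t)) powr (a + 1) = (1 + t) powr (- a - 1)"
        using that by (simp add: powr_divide powr_minus_divide[symmetric])
      moreover have "c * (1 + t) powr (- a - 1) * exp (- b / (1 + t)) \<le> c * (1 + t) powr (- a - 1) * 1"
        using that assms c by (intro mult_left_mono) auto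
      ultimately show ?thesis using that by (simp add: shifted_inv_gamma_density_def c_def)
    qed
    then show "ennreal (shifted_inv_gamma_density a b t)
        \<le> ennreal (c * (1 + t) powr (- a - 1)) * indicator {0..} t"
      by (cases "0 < t") (auto simp: ennreal_leI shifted_inv_gamma_density_def)
  qed
  also have "\<dots> = ennreal (0 - ?F 0)"
  proof (rule nn_integral_FTC_atLeast)
    show "((\<lambda>t. - (c / a) * (1 + t) powr (- a)) \<longlongrightarrow> 0) at_top"
      using assms by (intro tendsto_mult_right_zero tendsto_neg_powr
          filterlim_tendsto_add_at_top[OF tendsto_const] filterlim_ident) auto
    show "DERIV ?F t :> c * (1 + t) powr (- a - 1)" if "0 \<le> t" for t
      using that assms by (auto intro!: derivative_eq_intros simp: field_simps)
  qed (use c in auto)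
  finally show "emeasure (scale_law a b) (space (scale_law a b)) \<noteq> \<infinity>"
    by (auto simp: top_unique)
qed

lemma emeasure_scale_law_nonpos [simp]: "emeasure (scale_law a b) {..0} = 0"
  by (auto simp: scale_law_def emeasure_density shifted_inv_gamma_density_def indicator_def
      intro!: nn_integral_0_iff_AE[THEN iffD2])

text \<open>The density is strictly positive on the positive half-line, so a null law would force
  (0,1] to have Lebesgue measure 0.\<close>

lemma measure_scale_law_pos:
  assumes "0 < a" "0 < b"
  shows "0 < measure (scale_law a b) UNIV"
proof -
  interpret finite_measure "scale_law a b" by (rule finite_measure_scale_law) fact+
  have "emeasure (scale_law a b) {0<..} \<noteq> 0"
  proof
    assume "emeasure (scale_law a b) {0<..} = 0"
    then have "{0<..} \<in> null_sets (scale_law a b)" by auto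
    then have "AE t in lborel. t \<in> {0<..} \<longrightarrow> ennreal (shifted_inv_gamma_density a b t) = 0"
      unfolding scale_law_def by (subst (asm) null_sets_density_iff) auto
    then have "AE t in lborel. t \<notin> {0<..1::real}"
      by eventually_elim (use shifted_inv_gamma_density_pos[OF assms] in force)
    then have "emeasure lborel {0<..1::real} = 0"
      by (subst (asm) AE_iff_measurable[where N = "{0<..1}"]) auto
    then show False by simp
  qed
  then have "emeasure (scale_law a b) UNIV \<noteq> 0"
    using emeasure_mono[of "{0<..}" UNIV "scale_law a b"] by auto
  then show ?thesis
    by (simp add: emeasure_eq_measure zero_less_measure_iff)
qed

section \<open>Gaussian densities and the likelihood of one column\<close>

lemma gauss_density_pos: "0 < s2 \<Longrightarrow> 0 < gauss_density \<mu> s2 v"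
  by (simp add: gauss_density_def prod_pos normal_density_pos)

lemma gauss_density_nonneg [simp]: "0 \<le> gauss_density \<mu> s2 v"
  by (simp add: gauss_density_def prod_nonneg)

text \<open>The peak value bounds the density uniformly in mean and argument; this constant supplies
  the integrability of the likelihoods below.\<close>

lemma gauss_density_le:
  fixes v :: "real^'d::finite"
  assumes "0 < s2"
  shows "gauss_density \<mu> s2 v \<le> (1 / sqrt (2 * pi * s2)) ^ CARD('d)"
proof -
  have "normal_density m (sqrt s2) x \<le> 1 / sqrt (2 * pi * s2)" for m x
    using assms by (simp add: normal_density_def divide_right_mono)
  then show ?thesis
    unfolding gauss_density_def using prod_mono[of UNIV "\<lambda>i. normal_density (\<mu> $ i) (sqrt s2) (v $ i)"
        "\<lambda>_. 1 / sqrt (2 * pi * s2)"] by simp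
qed

lemma borel_measurable_vec_nth' [measurable]:
  assumes [measurable]: "f \<in> borel_measurable M"
  shows "(\<lambda>x. (f x :: real^'d) $ i) \<in> borel_measurable M"
proof -
  have "(\<lambda>v :: real^'d. v $ i) \<in> borel_measurable borel"
    by (intro borel_measurable_continuous_onI continuous_intros)
  then show ?thesis by (rule measurable_compose[OF assms])
qed

lemma borel_measurable_gauss_density [measurable]:
  assumes [measurable]: "f \<in> borel_measurable M" "g \<in> borel_measurable M"
  shows "(\<lambda>x. gauss_density (f x :: real^'d::finite) s2 (g x)) \<in> borel_measurable M"
  unfolding gauss_density_def normal_density_def by measurable

text \<open>Translation invariance of Lebesgue measure. The common value 1 is later read off the law
  of the observations instead of being computed.\<close>

lemma nn_integral_gauss_density_shift:
  fixes \<mu> :: "real^'d::finite"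
  shows "(\<integral>\<^sup>+ v. ennreal (gauss_density \<mu> s2 v) \<partial>lborel)
       = (\<integral>\<^sup>+ v. ennreal (gauss_density (0 :: real^'d) s2 v) \<partial>lborel)"
proof -
  have "(\<integral>\<^sup>+ v. ennreal (gauss_density \<mu> s2 v) \<partial>lborel)
      = (\<integral>\<^sup>+ v. ennreal (gauss_density \<mu> s2 v) \<partial>distr lborel borel ((+) \<mu>))"
    by (simp add: lborel_distr_plus)
  also have "\<dots> = (\<integral>\<^sup>+ v. ennreal (gauss_density \<mu> s2 (\<mu> + v)) \<partial>lborel)"
    by (rule nn_integral_distr) auto
  also have "\<dots> = (\<integral>\<^sup>+ v. ennreal (gauss_density (0 :: real^'d) s2 v) \<partial>lborel)"
    by (simp add: gauss_density_def normal_density_def)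
  finally show ?thesis .
qed

text \<open>This is x times the column of P numbered 0. The matrix-vector form matches
  \<open>latent_mean\<close>, and a switched-off entry can be modelled equally by
  \<open>x = 0\<close> or by \<open>P = 0\<close>.\<close>

definition spike :: "real^'d::finite^'d \<Rightarrow> real \<Rightarrow> real^'d" where
  "spike P x = P *v (\<chi> j. if to_nat_on (UNIV :: 'd set) j = 0 then x else 0)"

lemma spike_0 [simp]: "spike P 0 = 0" "spike 0 x = 0"
  by (simp_all add: spike_def matrix_vector_mult_def vec_eq_iff)

lemma borel_measurable_spike [measurable]:
  assumes [measurable]: "f \<in> borel_measurable M" "g \<in> borel_measurable M"
  shows "(\<lambda>x. spike (f x) (g x)) \<in> borel_measurable M"
proof -
  have *: "continuous_on UNIV (\<lambda>p. spike (fst p) (snd p))"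
    unfolding spike_def matrix_vector_mult_def vec_lambda_beta
    by (intro continuous_intros; rename_tac j; case_tac "to_nat_on UNIV j = (0 :: nat)")
       (auto intro!: continuous_intros)
  show ?thesis
    by (rule borel_measurable_continuous_Pair[OF assms *[unfolded case_prod_beta]]) 
qed

lemma latent_mean_single:
  "latent_mean P [h] X n = spike P (if n \<in> h then X (0, n) else 0)"
  unfolding latent_mean_def spike_def
  by (intro arg_cong2[where f = "(*v)"] refl) (auto simp: vec_eq_iff binary_entry_def Let_def)

lemma latent_mean_Nil [simp]: "latent_mean P [] X n = 0"
  by (simp add: latent_mean_def binary_entry_def Let_def matrix_vector_mult_def vec_eq_iff)

lemma borel_measurable_normal_density' [measurable]:
  assumes [measurable]: "f \<in> borel_measurable M" "g \<in> borel_measurable M"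
  shows "(\<lambda>x. normal_density 0 (f x) (g x)) \<in> borel_measurable M"
  unfolding normal_density_def by measurable

text \<open>Scales t outside the support of the prior also have to be handled: \<open>sqrt\<close>
  of a negative number is negative, but only its square enters the density, and for
  \<open>\<sigma> = 0\<close> division by zero makes the density vanish. Hence the bound 1 rather
  than equality.\<close>

lemma integrable_normal_density_any: "integrable lborel (normal_density \<mu> \<sigma>)"
  and integral_normal_density_le_1: "(\<integral>x. normal_density \<mu> \<sigma> x \<partial>lborel) \<le> 1"
proof -
  have "integrable lborel (normal_density \<mu> \<sigma>) \<and> (\<integral>x. normal_density \<mu> \<sigma> x \<partial>lborel) \<le> 1"
  proof (cases "\<sigma> = 0")
    case True
    then have "normal_density \<mu> \<sigma> = (\<lambda>_. 0)" by (simp add: fun_eq_iff normal_density_def)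
    then show ?thesis by simp
  next
    case False
    have "normal_density \<mu> \<sigma> = normal_density \<mu> \<bar>\<sigma>\<bar>" by (simp add: fun_eq_iff normal_density_def)
    moreover have "integrable lborel (normal_density \<mu> \<bar>\<sigma>\<bar>)"
      "(\<integral>x. normal_density \<mu> \<bar>\<sigma>\<bar> x \<partial>lborel) = 1"
      using False by (auto intro: integrable_normal_density integral_normal_density)
    ultimately show ?thesis by simp
  qed
  then show "integrable lborel (normal_density \<mu> \<sigma>)" "(\<integral>x. normal_density \<mu> \<sigma> x \<partial>lborel) \<le> 1"
    by auto
qed

text \<open>An inactive column is the case \<open>P = 0\<close>, where the integrand is a pure noise density.\<close>

definition column_likelihood :: "real \<Rightarrow> real^'d::finite^'d \<Rightarrow> real \<Rightarrow> real^'d \<Rightarrow> real" where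
  "column_likelihood s2 P t v =
     (\<integral>x. normal_density 0 (sqrt (t * s2)) x * gauss_density (spike P x) s2 v \<partial>lborel)"

lemma column_likelihood_nonneg [simp]: "0 \<le> column_likelihood s2 P t v"
  by (simp add: column_likelihood_def integral_nonneg_AE)

lemma borel_measurable_column_likelihood [measurable]:
  assumes [measurable]: "f \<in> borel_measurable M" "g \<in> borel_measurable M" "h \<in> borel_measurable M"
  shows "(\<lambda>x. column_likelihood s2 (f x) (g x) (h x)) \<in> borel_measurable M"
  unfolding column_likelihood_def by measurable

lemma integrable_column_likelihood_integrand:
  fixes P :: "real^'d::finite^'d"
  assumes "0 < s2"
  shows "integrable lborel (\<lambda>x. normal_density 0 (sqrt (t * s2)) x * gauss_density (spike P x) s2 v)"
proof (rule Bochner_Integration.integrable_bound)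
  show "integrable lborel (\<lambda>x. normal_density 0 (sqrt (t * s2)) x * (1 / sqrt (2 * pi * s2)) ^ CARD('d))"
    by (intro integrable_mult_left integrable_normal_density_any)
qed (auto simp: abs_mult intro!: mult_left_mono gauss_density_le[OF assms, THEN order_trans])

lemma column_likelihood_le:
  fixes P :: "real^'d::finite^'d"
  assumes "0 < s2"
  shows "column_likelihood s2 P t v \<le> (1 / sqrt (2 * pi * s2)) ^ CARD('d)"
proof -
  let ?C = "(1 / sqrt (2 * pi * s2)) ^ CARD('d)"
  have "column_likelihood s2 P t v \<le> (\<integral>x. normal_density 0 (sqrt (t * s2)) x * ?C \<partial>lborel)"
    unfolding column_likelihood_def using assms
    by (intro integral_mono integrable_column_likelihood_integrand integrable_mult_left
        integrable_normal_density_any mult_left_mono gauss_density_le) auto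
  also have "\<dots> = (\<integral>x. normal_density 0 (sqrt (t * s2)) x \<partial>lborel) * ?C" by simp
  also have "\<dots> \<le> 1 * ?C"
    using assms by (intro mult_right_mono integral_normal_density_le_1) auto
  finally show ?thesis by simp
qed

lemma column_likelihood_0:
  assumes "0 < s2" "0 < t"
  shows "column_likelihood s2 0 t v = gauss_density 0 s2 v"
  using assms by (simp add: column_likelihood_def)

text \<open>By Tonelli, v is integrated first: each Gaussian has mass 1 whatever its mean, and what
  remains is the mass of the coefficient prior. This is why the likelihood ratio has mean one under
  pure noise.\<close>

lemma nn_integral_column_likelihood:
  fixes P :: "real^'d::finite^'d"
  assumes "0 < s2" "0 < t"
    and 1: "(\<integral>\<^sup>+ v. ennreal (gauss_density (0 :: real^'d) s2 v) \<partial>lborel) = 1"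
  shows "(\<integral>\<^sup>+ v. ennreal (column_likelihood s2 P t v) \<partial>lborel) = 1"
proof -
  let ?n = "\<lambda>x. normal_density 0 (sqrt (t * s2)) x"
  have 1: "(\<integral>\<^sup>+ v. ennreal (gauss_density \<mu> s2 v) \<partial>lborel) = 1" for \<mu> :: "real^'d"
    using 1 nn_integral_gauss_density_shift[of \<mu> s2] by simp
  have "(\<integral>\<^sup>+ v. ennreal (column_likelihood s2 P t v) \<partial>lborel)
      = (\<integral>\<^sup>+ v. \<integral>\<^sup>+ x. ennreal (?n x * gauss_density (spike P x) s2 v) \<partial>lborel \<partial>lborel)"
    unfolding column_likelihood_def using assms
    by (intro nn_integral_cong nn_integral_eq_integral[symmetric] integrable_column_likelihood_integrand) auto
  also have "\<dots> = (\<integral>\<^sup>+ x. \<integral>\<^sup>+ v. ennreal (?n x * gauss_density (spike P x) s2 v) \<partial>lborel \<partial>lborel)"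
    by (rule lborel_pair.Fubini') measurable
  also have "\<dots> = (\<integral>\<^sup>+ x. ennreal (?n x) \<partial>lborel)"
    by (simp add: ennreal_mult nn_integral_cmult 1)
  also have "\<dots> = ennreal (\<integral>x. ?n x \<partial>lborel)"
    by (intro nn_integral_eq_integral integrable_normal_density_any) auto
  finally show ?thesis using assms by simp
qed

section \<open>Factorisation of the one-row likelihood over columns\<close>

text \<open>Column n involves only the coefficient (0, n), so the integral over the product measure
  splits into one-dimensional integrals.\<close>

lemma integral_coeff_prior_single:
  fixes Y :: "nat \<Rightarrow> real^'d::finite"
  assumes "0 < s2"
  shows "(\<integral>X. (\<Prod>n=1..N. gauss_density (latent_mean P [h] X n) s2 (Y n)) \<partial>coeff_prior s2 \<delta>2 (Suc 0) N)
       = (\<Prod>n=1..N. column_likelihood s2 (if n \<in> h then P else 0) (\<delta>2 0) (Y n))"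
proof -
  define L where "L = (\<lambda>(k::nat, n::nat).
    density lborel (\<lambda>x. ennreal (normal_density 0 (sqrt (\<delta>2 k * s2)) x)))"
  \<comment> \<open>For arbitrary \<open>\<delta>2\<close> the factors need not be probability
    measures; finiteness is enough for the product formula.\<close>
  have fin: "finite_measure (L i)" for i
  proof (rule finite_measureI)
    have "emeasure (L i) (space (L i)) = (\<integral>\<^sup>+ x. ennreal (normal_density 0 (sqrt (\<delta>2 (fst i) * s2)) x) \<partial>lborel)"
      by (simp add: L_def case_prod_beta emeasure_density)
    also have "\<dots> = ennreal (\<integral>x. normal_density 0 (sqrt (\<delta>2 (fst i) * s2)) x \<partial>lborel)"
      by (intro nn_integral_eq_integral integrable_normal_density_any) auto
    finally show "emeasure (L i) (space (L i)) \<noteq> \<infinity>" by simp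
  qed
  then interpret product_sigma_finite L
    by (simp add: product_sigma_finite_def finite_measure_def)
  have [measurable_cong]: "sets (L i) = sets borel" for i
    by (simp add: L_def case_prod_beta)
  let ?I = "{..<Suc 0} \<times> {1..N}"
  \<comment> \<open>An inactive column switches off the matrix instead of the coefficient, so all
    columns have an integrand of the same shape.\<close>
  let ?f = "\<lambda>(i :: nat \<times> nat) x. gauss_density (spike (if snd i \<in> h then P else 0) x) s2 (Y (snd i))"
  have reindex: "(\<Prod>n=1..N. F (0, n)) = (\<Prod>i\<in>?I. F i)" for F :: "nat \<times> nat \<Rightarrow> real"
    by (rule prod.reindex_bij_witness[where i = snd and j = "\<lambda>n. (0, n)"]) auto
  have int: "integrable (L i) (?f i)" for i
  proof -
    interpret finite_measure "L i" by (rule fin)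
    show ?thesis
      by (rule integrable_const_bound[where B = "(1 / sqrt (2 * pi * s2)) ^ CARD('d)"])
         (use gauss_density_le[OF assms] in auto)
  qed
  have "(\<integral>X. (\<Prod>n=1..N. gauss_density (latent_mean P [h] X n) s2 (Y n)) \<partial>coeff_prior s2 \<delta>2 (Suc 0) N)
      = (\<integral>X. (\<Prod>i\<in>?I. ?f i (X i)) \<partial>Pi\<^sub>M ?I L)"
    unfolding coeff_prior_def L_def[symmetric]
    by (subst reindex[symmetric]) (auto intro!: Bochner_Integration.integral_cong prod.cong simp: latent_mean_single)
  also have "\<dots> = (\<Prod>i\<in>?I. integral\<^sup>L (L i) (?f i))"
    by (rule product_integral_prod) (use int in auto)
  also have "\<dots> = (\<Prod>n=1..N. integral\<^sup>L (L (0, n)) (?f (0, n)))"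
    by (rule reindex[symmetric])
  also have "\<dots> = (\<Prod>n=1..N. column_likelihood s2 (if n \<in> h then P else 0) (\<delta>2 0) (Y n))"
    unfolding L_def column_likelihood_def by (intro prod.cong refl) (simp add: integral_density)
  finally show ?thesis .
qed

lemma integral_scale_prior_single:
  assumes "0 < a" "0 < b" and [measurable]: "g \<in> borel_measurable borel"
  shows "(\<integral>\<delta>2. g (\<delta>2 0) \<partial>scale_prior a b (Suc 0)) = (\<integral>t. g t \<partial>scale_law a b :: real)"
proof -
  interpret finite_measure "scale_law a b" by (rule finite_measure_scale_law) fact+
  interpret product_sigma_finite "\<lambda>_::nat. scale_law a b"
    by unfold_locales (rule sigma_finite_countable)
  have "{..<Suc 0} = {0}" by auto
  then show ?thesis
    unfolding scale_prior_def scale_law_def[symmetric] by (simp add: product_integral_singleton)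
qed

lemma AE_scale_law_pos: "AE t in scale_law a b. 0 < t"
  by (rule AE_I[where N = "{..0}"]) auto

section \<open>Likelihood ratios over the joint parameter of rotation and scale\<close>

locale spike_model =
  fixes H :: "(real^'d::finite^'d) measure" and a b s2 :: real
  assumes a: "0 < a" and b: "0 < b" and s2: "0 < s2" and haar: "haar_orthogonal H"
begin

sublocale H: prob_space H using haar by (simp add: haar_orthogonal_def)

lemma sets_H [simp, measurable_cong]: "sets H = sets borel"
  using haar by (simp add: haar_orthogonal_def)

sublocale S: finite_measure "scale_law a b" by (rule finite_measure_scale_law[OF a b])

definition Q :: "((real^'d^'d) \<times> real) measure" where "Q = H \<Otimes>\<^sub>M scale_law a b"

lemma sets_Q [measurable_cong]: "sets Q = sets (borel \<Otimes>\<^sub>M borel)"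
  unfolding Q_def by (rule sets_pair_measure_cong) simp_all

sublocale HS: pair_sigma_finite H "scale_law a b" ..

sublocale Q: finite_measure Q
  unfolding Q_def by (rule finite_measure_pair_measure) (unfold_locales)

definition mass :: real where "mass = measure (scale_law a b) UNIV"

lemma mass_pos: "0 < mass" unfolding mass_def by (rule measure_scale_law_pos[OF a b])

lemma measure_Q: "measure Q (space Q) = mass"
proof -
  have "emeasure Q (space Q) = emeasure H (space H) * emeasure (scale_law a b) UNIV"
    unfolding Q_def space_pair_measure space_scale_law
    by (rule S.emeasure_pair_measure_Times) (use sets.top[of H] sets_H in auto)
  then show ?thesis
    by (simp add: H.emeasure_space_1 mass_def measure_def)
qed

lemma AE_Q_pos: "AE q in Q. 0 < snd q"
proof -
  have "AE P in H. AE t in scale_law a b. 0 < snd (P, t)"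
    using AE_scale_law_pos by simp
  then show ?thesis
    unfolding Q_def by (intro HS.AE_pair_measure) measurable
qed

definition ratio :: "real^'d \<Rightarrow> (real^'d^'d) \<times> real \<Rightarrow> real" where
  "ratio v q = column_likelihood s2 (fst q) (snd q) v / gauss_density 0 s2 v"

lemma ratio_nonneg [simp]: "0 \<le> ratio v q" by (simp add: ratio_def)

lemma borel_measurable_ratio [measurable]:
  assumes [measurable]: "f \<in> borel_measurable M" "g \<in> M \<rightarrow>\<^sub>M borel \<Otimes>\<^sub>M borel"
  shows "(\<lambda>x. ratio (f x) (g x)) \<in> borel_measurable M"
  unfolding ratio_def by measurable

lemma marginal_likelihood_rows_Nil:
  "marginal_likelihood_rows H a b s2 N Y [] = (\<Prod>n=1..N. gauss_density 0 s2 (Y n))"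
  by (simp add: marginal_likelihood_rows_def scale_prior_def coeff_prior_def PiM_empty H.prob_space)

text \<open>The bound is uniform in q but depends on the observation v; it makes products of ratios
  integrable for fixed data. A bound uniform in v is obtained later by capping.\<close>

lemma ratio_le: "ratio v q \<le> (1 / sqrt (2 * pi * s2)) ^ CARD('d) / gauss_density 0 s2 v"
  unfolding ratio_def by (intro divide_right_mono column_likelihood_le s2) auto

lemma integrable_prod_ratio: "integrable Q (\<lambda>q. \<Prod>n\<in>h. ratio (Y n) q)"
proof (rule Q.integrable_const_bound)
  show "AE q in Q. norm (\<Prod>n\<in>h. ratio (Y n) q)
      \<le> (\<Prod>n\<in>h. (1 / sqrt (2 * pi * s2)) ^ CARD('d) / gauss_density 0 s2 (Y n))"
    by (auto simp: abs_prod intro!: prod_mono ratio_le)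
qed measurable

text \<open>Dividing every column by its noise density leaves the ratio on \<open>h\<close> and 1
  elsewhere; Fubini then joins the two parameter integrals into one over \<open>Q\<close>.\<close>

lemma marginal_likelihood_rows_single:
  assumes h: "h \<subseteq> {1..N}"
  shows "marginal_likelihood_rows H a b s2 N Y [h]
       = (\<Prod>n=1..N. gauss_density 0 s2 (Y n)) * (\<integral>q. (\<Prod>n\<in>h. ratio (Y n) q) \<partial>Q)"
proof -
  let ?L0 = "\<Prod>n=1..N. gauss_density 0 s2 (Y n)"
  have len: "length [h] = Suc 0" by simp
  have "marginal_likelihood_rows H a b s2 N Y [h]
      = (\<integral>P. \<integral>\<delta>2. (\<Prod>n=1..N. column_likelihood s2 (if n \<in> h then P else 0) (\<delta>2 0) (Y n))
          \<partial>scale_prior a b (Suc 0) \<partial>H)"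
    unfolding marginal_likelihood_rows_def len integral_coeff_prior_single[OF s2] ..
  also have "\<dots> = (\<integral>P. \<integral>t. (\<Prod>n=1..N. column_likelihood s2 (if n \<in> h then P else 0) t (Y n))
          \<partial>scale_law a b \<partial>H)"
    by (subst integral_scale_prior_single[OF a b]) auto
  also have "\<dots> = (\<integral>P. \<integral>t. ?L0 * (\<Prod>n\<in>h. ratio (Y n) (P, t)) \<partial>scale_law a b \<partial>H)"
  proof (rule Bochner_Integration.integral_cong[OF refl], rule integral_cong_AE)
    fix P
    show "AE t in scale_law a b. (\<Prod>n=1..N. column_likelihood s2 (if n \<in> h then P else 0) t (Y n))
        = ?L0 * (\<Prod>n\<in>h. ratio (Y n) (P, t))"
      \<comment> \<open>An inactive column reduces to pure noise because its coefficient prior has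
        mass 1, which needs \<open>0 < t\<close>.\<close>
      using AE_scale_law_pos
    proof eventually_elim
      case (elim t)
      have "(\<Prod>n=1..N. column_likelihood s2 (if n \<in> h then P else 0) t (Y n))
          = (\<Prod>n=1..N. gauss_density 0 s2 (Y n) * (if n \<in> h then ratio (Y n) (P, t) else 1))"
        using gauss_density_pos[OF s2, of 0] elim s2
        by (intro prod.cong) (auto simp: ratio_def column_likelihood_0 less_le)
      also have "\<dots> = ?L0 * (\<Prod>n\<in>{1..N} \<inter> h. ratio (Y n) (P, t))"
        by (simp add: prod.distrib prod.inter_restrict)
      finally show ?case using h by (simp add: Int_absorb1)
    qed
  qed measurable
  also have "\<dots> = ?L0 * (\<integral>q. (\<Prod>n\<in>h. ratio (Y n) q) \<partial>Q)"
    using HS.integral_fst'[of "\<lambda>q. \<Prod>n\<in>h. ratio (Y n) q"] integrable_prod_ratio[of Y h]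
    by (simp add: Q_def)
  finally show ?thesis .
qed

end

section \<open>The Indian buffet prior on matrices with at most one row\<close>

lemma binary_matrices_0: "binary_matrices N 0 = {{#}}"
  by (auto simp: binary_matrices_def)

lemma binary_matrices_1: "binary_matrices N (Suc 0) = (\<lambda>h. {#h#}) ` histories N"
  by (auto simp: binary_matrices_def dest!: size_1_singleton_mset[unfolded One_nat_def])

lemma finite_histories [simp]: "finite (histories N)"
  by (simp add: histories_def)

lemma ibp_prior_nonneg:
  assumes "0 \<le> \<alpha>"
  shows "0 \<le> ibp_prior D \<alpha> N Z"
proof -
  have "0 \<le> (\<Prod>h\<in>#Z. fact (N - card h) * fact (card h - 1) / fact N :: real)"
    by (induction Z) auto
  with assms show ?thesis
    unfolding ibp_prior_def by (auto intro!: mult_nonneg_nonneg divide_nonneg_nonneg prod_nonneg)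
qed

lemma ibp_prior_empty: "ibp_prior D \<alpha> N {#} = exp (- \<alpha> * (\<Sum>n=1..N. 1 / real n))"
  by (simp add: ibp_prior_def)

lemma ibp_prior_single:
  assumes "1 \<le> D"
  shows "ibp_prior D \<alpha> N {#h#}
       = \<alpha> * exp (- \<alpha> * (\<Sum>n=1..N. 1 / real n)) * (fact (N - card h) * fact (card h - 1) / fact N)"
proof -
  have "(\<Prod>h'\<in>histories N. fact (count {#h#} h')) = (1 :: real)"
    by (intro prod.neutral) auto
  then show ?thesis using assms by (simp only: ibp_prior_def) simp
qed

text \<open>The prior factor of a row with m ones is 1/m times the uniform weight on m-subsets. This
  is the source of the harmonic series.\<close>

lemma fact_mult_fact_div_fact:
  assumes "1 \<le> m" "m \<le> N"
  shows "fact (N - m) * fact (m - 1) / fact N = 1 / (real m * real (N choose m))"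
  using assms by (subst binomial_fact) (auto simp: fact_reduce field_simps)

lemma sum_histories:
  fixes g :: "nat set \<Rightarrow> real"
  shows "(\<Sum>h\<in>histories N. g h) = (\<Sum>m=1..N. \<Sum>h | h \<subseteq> {1..N} \<and> card h = m. g h)"
proof -
  have "card h \<in> {1..N}" if "h \<in> histories N" for h
    using that card_mono[of "{1..N}" h] finite_subset[of h "{1..N}"]
    by (auto simp: histories_def Suc_le_eq card_gt_0_iff)
  then have "(\<Sum>h\<in>histories N. g h) = (\<Sum>m=1..N. \<Sum>h | h \<in> histories N \<and> card h = m. g h)"
    by (intro sum.group[symmetric]) auto
  also have "\<dots> = (\<Sum>m=1..N. \<Sum>h | h \<subseteq> {1..N} \<and> card h = m. g h)"
    by (intro sum.cong refl) (auto simp: histories_def)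
  finally show ?thesis .
qed

section \<open>Weights of the models with zero and one row\<close>

context spike_model
begin

lemma marginal_likelihood_nonneg: "0 \<le> marginal_likelihood H a b s2 N Y Z"
  unfolding marginal_likelihood_def marginal_likelihood_rows_def
  by (intro Bochner_Integration.integral_nonneg prod_nonneg ballI gauss_density_nonneg)

lemma joint_weight_nonneg: "0 \<le> \<alpha> \<Longrightarrow> 0 \<le> joint_weight H a b \<alpha> s2 N Y k"
  unfolding joint_weight_def
  by (intro sum_nonneg mult_nonneg_nonneg ibp_prior_nonneg marginal_likelihood_nonneg)

lemma joint_weight_0:
  "joint_weight H a b \<alpha> s2 N Y 0
   = exp (- \<alpha> * (\<Sum>n=1..N. 1 / real n)) * (\<Prod>n=1..N. gauss_density 0 s2 (Y n))"
  unfolding joint_weight_def binary_matrices_0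
  by (simp add: ibp_prior_empty marginal_likelihood_def marginal_likelihood_rows_Nil)

lemma joint_weight_0_pos: "0 < joint_weight H a b \<alpha> s2 N Y 0"
  unfolding joint_weight_0 by (intro mult_pos_pos prod_pos gauss_density_pos s2) auto

lemma joint_weight_1:
  "joint_weight H a b \<alpha> s2 N Y (Suc 0) = joint_weight H a b \<alpha> s2 N Y 0 * (\<alpha> *
     (\<Sum>m=1..N. 1 / (real m * real (N choose m)) *
        (\<Sum>h | h \<subseteq> {1..N} \<and> card h = m. \<integral>q. (\<Prod>n\<in>h. ratio (Y n) q) \<partial>Q)))"
proof -
  define w where "w = joint_weight H a b \<alpha> s2 N Y 0"
  have "joint_weight H a b \<alpha> s2 N Y (Suc 0)
      = (\<Sum>h\<in>histories N. ibp_prior CARD('d) \<alpha> N {#h#} * marginal_likelihood H a b s2 N Y {#h#})"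
    unfolding joint_weight_def binary_matrices_1 by (subst sum.reindex) (auto simp: inj_on_def)
  also have "\<dots> = (\<Sum>h\<in>histories N. w * \<alpha> * (fact (N - card h) * fact (card h - 1) / fact N
        * (\<integral>q. (\<Prod>n\<in>h. ratio (Y n) q) \<partial>Q)))"
    \<comment> \<open>For a singleton multiset the choice \<open>SOME zs\<close> can only return
      \<open>[h]\<close>.\<close>
    by (intro sum.cong refl, subst ibp_prior_single)
       (auto simp: histories_def marginal_likelihood_def marginal_likelihood_rows_single
          w_def joint_weight_0 Suc_le_eq)
  also have "\<dots> = w * \<alpha> * (\<Sum>m=1..N. \<Sum>h | h \<subseteq> {1..N} \<and> card h = m.
      fact (N - card h) * fact (card h - 1) / fact N * (\<integral>q. (\<Prod>n\<in>h. ratio (Y n) q) \<partial>Q))"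
    by (simp only: sum_distrib_left[symmetric] sum_histories)
  also have "\<dots> = w * \<alpha> * (\<Sum>m=1..N. 1 / (real m * real (N choose m)) *
        (\<Sum>h | h \<subseteq> {1..N} \<and> card h = m. \<integral>q. (\<Prod>n\<in>h. ratio (Y n) q) \<partial>Q))"
    by (intro arg_cong2[where f = "(*)"] refl sum.cong, subst sum_distrib_left, intro sum.cong refl)
       (auto simp: fact_mult_fact_div_fact[symmetric])
  finally show ?thesis by (simp add: w_def)
qed

section \<open>Lower bounds through capped likelihood ratios\<close>

text \<open>Averaging over q before letting N grow turns the limit into a law of large numbers for a
  single function of the data, instead of one for each of uncountably many q.\<close>

definition capped_mean :: "real \<Rightarrow> real^'d \<Rightarrow> real" where
  "capped_mean B v = (\<integral>q. min (ratio v q) B \<partial>Q)"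

lemma integrable_capped: "0 \<le> B \<Longrightarrow> integrable Q (\<lambda>q. min (ratio v q) B)"
  by (rule Q.integrable_const_bound[where B = B]) auto

lemma borel_measurable_capped_mean [measurable]: "capped_mean B \<in> borel_measurable borel"
  unfolding capped_mean_def[abs_def] by measurable

lemma capped_mean_bounds:
  assumes "0 \<le> B"
  shows "capped_mean B v \<in> {0..mass * B}"
proof -
  have "capped_mean B v \<le> (\<integral>q. B \<partial>Q)"
    unfolding capped_mean_def using assms by (intro integral_mono integrable_capped) auto
  then show ?thesis
    using assms by (auto simp: capped_mean_def measure_Q intro!: integral_nonneg_AE)
qed

text \<open>Bernoulli's inequality makes the lower bound linear in the sum over \<open>n\<close>, so integrating over
  the parameters \<open>q\<close> leaves an empirical mean of a fixed function of the data.\<close>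

lemma elementary_symmetric_ratio_ge:
  assumes "0 \<le> B" and m: "1 \<le> m" "m \<le> N"
  shows "mass * (1 - real m - (real m)\<^sup>2 * B / real N) + real m * ((\<Sum>n=1..N. capped_mean B (Y n)) / real N)
       \<le> 1 / real (N choose m) * (\<Sum>h | h \<subseteq> {1..N} \<and> card h = m. \<integral>q. (\<Prod>n\<in>h. ratio (Y n) q) \<partial>Q)"
proof -
  have N: "0 < N" using m by simp
  let ?r = "\<lambda>q n. min (ratio (Y n) q) B"
  have int_r: "integrable Q (\<lambda>q. \<Sum>n=1..N. ?r q n)"
    by (intro Bochner_Integration.integrable_sum integrable_capped assms)
  have "mass * (1 - real m - (real m)\<^sup>2 * B / real N) + real m * ((\<Sum>n=1..N. capped_mean B (Y n)) / real N)
      = (\<integral>q. (1 - real m - (real m)\<^sup>2 * B / real N) + real m * ((\<Sum>n=1..N. ?r q n) / real N) \<partial>Q)"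
    using int_r assms
    by (subst Bochner_Integration.integral_add)
       (auto simp: measure_Q capped_mean_def integrable_capped)
  also have "\<dots> = (\<integral>q. 1 + real m * (((\<Sum>n=1..N. ?r q n) - real m * B) / card {1..N} - 1) \<partial>Q)"
    using N by (intro Bochner_Integration.integral_cong refl) (simp add: field_simps power2_eq_square)
  also have "\<dots> \<le> (\<integral>q. 1 / real (N choose m) * (\<Sum>h | h \<subseteq> {1..N} \<and> card h = m. \<Prod>n\<in>h. ratio (Y n) q) \<partial>Q)"
  proof (rule integral_mono)
    fix q
    have "1 + real m * (((\<Sum>n=1..N. ?r q n) - real m * B) / card {1..N} - 1)
        \<le> (\<Sum>h | h \<subseteq> {1..N} \<and> card h = m. \<Prod>n\<in>h. ?r q n) / (card {1..N} choose m)"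
      using assms by (intro elementary_symmetric_mean_ge) auto
    \<comment> \<open>Removing the cap only increases products of nonnegative factors.\<close>
    also have "\<dots> \<le> (\<Sum>h | h \<subseteq> {1..N} \<and> card h = m. \<Prod>n\<in>h. ratio (Y n) q) / (N choose m)"
      using assms by (auto intro!: divide_right_mono sum_mono prod_mono)
    finally show "1 + real m * (((\<Sum>n=1..N. ?r q n) - real m * B) / card {1..N} - 1)
        \<le> 1 / real (N choose m) * (\<Sum>h | h \<subseteq> {1..N} \<and> card h = m. \<Prod>n\<in>h. ratio (Y n) q)"
      by simp
  qed (use int_r in \<open>auto intro!: integrable_prod_ratio\<close>)
  also have "\<dots> = 1 / real (N choose m) * (\<Sum>h | h \<subseteq> {1..N} \<and> card h = m. \<integral>q. (\<Prod>n\<in>h. ratio (Y n) q) \<partial>Q)"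
    by (simp add: integrable_prod_ratio)
  finally show ?thesis .
qed

text \<open>The error term with \<open>m\<^sup>2 * B / N\<close> is harmless only for bounded m. So
  just the sizes up to a cutoff \<open>T\<close> are estimated; the larger sizes contribute
  nonnegative terms and are dropped.\<close>

lemma joint_weight_1_ge:
  assumes "0 \<le> \<alpha>" "0 \<le> B" "T \<le> N"
  shows "joint_weight H a b \<alpha> s2 N Y 0 * (\<alpha> * (\<Sum>m=1..T. 1 / m *
           (mass * (1 - real m - (real m)\<^sup>2 * B / real N) + real m * ((\<Sum>n=1..N. capped_mean B (Y n)) / real N))))
       \<le> joint_weight H a b \<alpha> s2 N Y (Suc 0)"
proof -
  let ?e = "\<lambda>m. \<Sum>h | h \<subseteq> {1..N} \<and> card h = m. \<integral>q. (\<Prod>n\<in>h. ratio (Y n) q) \<partial>Q"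
  have e: "0 \<le> ?e m" for m
    by (auto intro!: sum_nonneg integral_nonneg_AE prod_nonneg)
  have "(\<Sum>m=1..T. 1 / real m * (mass * (1 - real m - (real m)\<^sup>2 * B / real N) + real m * ((\<Sum>n=1..N. capped_mean B (Y n)) / real N)))
      \<le> (\<Sum>m=1..T. 1 / real m * (1 / real (N choose m) * ?e m))"
    using assms by (intro sum_mono mult_left_mono elementary_symmetric_ratio_ge) auto
  also have "\<dots> \<le> (\<Sum>m=1..N. 1 / real m * (1 / real (N choose m) * ?e m))"
    using assms e by (intro sum_mono2) auto
  finally have "(\<Sum>m=1..T. 1 / real m * (mass * (1 - real m - (real m)\<^sup>2 * B / real N) + real m * ((\<Sum>n=1..N. capped_mean B (Y n)) / real N)))
      \<le> (\<Sum>m=1..N. 1 / (real m * real (N choose m)) * ?e m)" by simp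
  then show ?thesis
    unfolding joint_weight_1
    using joint_weight_0_pos[of \<alpha> N Y] assms by (intro mult_left_mono) auto
qed

text \<open>All weights are nonnegative and the dimension is at least 1, so the normalising sum
  contains the weight of the one-row model.\<close>

lemma posterior_dim_0_le:
  assumes "0 \<le> \<alpha>" "0 < K"
    and le: "joint_weight H a b \<alpha> s2 N Y 0 * K \<le> joint_weight H a b \<alpha> s2 N Y (Suc 0)"
  shows "posterior_dim H a b \<alpha> s2 N Y 0 \<in> {0..1 / K}"
proof -
  let ?w = "joint_weight H a b \<alpha> s2 N Y"
  have w0: "0 < ?w 0" by (rule joint_weight_0_pos)
  have "?w 0 + ?w (Suc 0) = (\<Sum>k\<in>{0, Suc 0}. ?w k)" by simp
  also have "\<dots> \<le> (\<Sum>k=0..CARD('d). ?w k)"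
    using assms by (intro sum_mono2) (auto simp: joint_weight_nonneg Suc_le_eq)
  finally have "?w 0 * K \<le> (\<Sum>k=0..CARD('d). ?w k)" using le w0 by linarith
  moreover have "0 < ?w 0 * K" using w0 assms by simp
  ultimately have "?w 0 / (\<Sum>k=0..CARD('d). ?w k) \<le> ?w 0 / (?w 0 * K)"
    using w0 by (intro divide_left_mono) auto
  then show ?thesis
    using w0 joint_weight_nonneg[of \<alpha> N Y] assms
    by (auto simp: posterior_dim_def intro!: divide_nonneg_nonneg sum_nonneg)
qed

text \<open>Under the null, the likelihood ratio has mean one for every parameter value, so the cap is
  asymptotically harmless.\<close>

lemma tendsto_mean_capped_mean:
  assumes 1: "(\<integral>\<^sup>+ v. ennreal (gauss_density (0 :: real^'d) s2 v) \<partial>lborel) = 1"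
  shows "(\<lambda>B :: nat. \<integral>v. gauss_density 0 s2 v * capped_mean (real B) v \<partial>lborel) \<longlonglongrightarrow> mass"
proof -
  define G where "G = density lborel (\<lambda>v :: real^'d. ennreal (gauss_density 0 s2 v))"
  have [simp, measurable_cong]: "sets G = sets borel" by (simp add: G_def)
  interpret G: prob_space G
    by (rule prob_spaceI) (simp add: G_def emeasure_density 1)
  interpret GQ: pair_sigma_finite G Q ..
  interpret GQ: finite_measure "G \<Otimes>\<^sub>M Q"
    by (rule finite_measure_pair_measure) unfold_locales
  let ?r = "\<lambda>(v, q). ratio v q"
  have [measurable]: "?r \<in> borel_measurable (G \<Otimes>\<^sub>M Q)"
    unfolding case_prod_beta by measurable
  \<comment> \<open>Tonelli puts the integral over the data inside, where the ratio has mean one for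
    each fixed q with positive scale.\<close>
  have "(\<integral>\<^sup>+ p. ennreal (?r p) \<partial>(G \<Otimes>\<^sub>M Q)) = (\<integral>\<^sup>+ q. \<integral>\<^sup>+ v. ennreal (ratio v q) \<partial>G \<partial>Q)"
    by (subst GQ.nn_integral_snd[symmetric]) (simp_all add: case_prod_beta[symmetric])
  also have "\<dots> = (\<integral>\<^sup>+ q. 1 \<partial>Q)"
  proof (rule nn_integral_cong_AE, use AE_Q_pos in eventually_elim)
    case (elim q)
    have [measurable]: "(\<lambda>v. ratio v q) \<in> borel_measurable borel"
      unfolding ratio_def by measurable
    have "(\<integral>\<^sup>+ v. ennreal (ratio v q) \<partial>G)
        = (\<integral>\<^sup>+ v. ennreal (gauss_density 0 s2 v) * ennreal (ratio v q) \<partial>lborel)"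
      unfolding G_def by (rule nn_integral_density) measurable
    also have "\<dots> = (\<integral>\<^sup>+ v. ennreal (column_likelihood s2 (fst q) (snd q) v) \<partial>lborel)"
      using gauss_density_pos[OF s2, of 0]
      by (intro nn_integral_cong) (auto simp: ratio_def ennreal_mult[symmetric] less_le)
    also have "\<dots> = 1" by (rule nn_integral_column_likelihood[OF s2 elim 1])
    finally show ?case .
  qed
  also have "\<dots> = ennreal mass" by (simp add: Q.emeasure_eq_measure measure_Q)
  finally have nn: "(\<integral>\<^sup>+ p. ennreal (?r p) \<partial>(G \<Otimes>\<^sub>M Q)) = ennreal mass" .
  then have int: "integrable (G \<Otimes>\<^sub>M Q) ?r" and eq: "(\<integral>p. ?r p \<partial>(G \<Otimes>\<^sub>M Q)) = mass"
    using mass_pos by (auto intro!: integrableI_nonneg simp: integral_eq_nn_integral case_prod_beta)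
  \<comment> \<open>The uncapped ratio is integrable over the product, so it serves as its own
    dominating function.\<close>
  have "(\<lambda>B :: nat. \<integral>p. min (?r p) B \<partial>(G \<Otimes>\<^sub>M Q)) \<longlonglongrightarrow> (\<integral>p. ?r p \<partial>(G \<Otimes>\<^sub>M Q))"
  proof (rule integral_dominated_convergence[where w = ?r])
    show "AE p in G \<Otimes>\<^sub>M Q. (\<lambda>B :: nat. min (?r p) B) \<longlonglongrightarrow> ?r p"
    proof (rule AE_I2)
      fix p
      have "eventually (\<lambda>B :: nat. ?r p \<le> B) sequentially"
        using filterlim_real_sequentially by (auto simp: filterlim_at_top)
      then have "eventually (\<lambda>B :: nat. min (?r p) B = ?r p) sequentially"
        by eventually_elim simp
      then show "(\<lambda>B :: nat. min (?r p) B) \<longlonglongrightarrow> ?r p" by (rule tendsto_eventually)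
    qed
  qed (use int in \<open>auto simp: case_prod_beta\<close>)
  moreover have "(\<integral>p. min (?r p) B \<partial>(G \<Otimes>\<^sub>M Q)) = (\<integral>v. gauss_density 0 s2 v * capped_mean B v \<partial>lborel)"
    for B :: nat
  proof -
    have "integrable (G \<Otimes>\<^sub>M Q) (\<lambda>(v, q). min (ratio v q) B)"
      by (rule GQ.integrable_const_bound[where B = B]) (auto simp: case_prod_beta)
    then have "(\<integral>p. min (?r p) B \<partial>(G \<Otimes>\<^sub>M Q)) = (\<integral>v. capped_mean B v \<partial>G)"
      unfolding capped_mean_def using GQ.integral_fst'[of "\<lambda>(v, q). min (ratio v q) B"]
      by (simp add: case_prod_beta')
    also have "\<dots> = (\<integral>v. gauss_density 0 s2 v * capped_mean B v \<partial>lborel)"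
      unfolding G_def by (simp add: integral_density)
    finally show ?thesis .
  qed
  ultimately show ?thesis by (simp add: eq)
qed

end

section \<open>Almost sure divergence of the weight ratio\<close>

theorem theorem2:
  fixes M :: "'w measure"
    and y :: "nat \<Rightarrow> 'w \<Rightarrow> real^'d::finite"
    and H :: "(real^'d^'d) measure"
    and \<alpha> a b s2 :: real
  assumes "\<alpha> > 0" and "a > 0" and "b > 0" and "s2 > 0"
    and "haar_orthogonal H"
    and "prob_space M"
    and "prob_space.indep_vars M (\<lambda>_. borel) y {1..}"
    and "\<And>n. n \<ge> 1 \<Longrightarrow> distributed M lborel (y n) (\<lambda>v. ennreal (gauss_density 0 s2 v))"
  shows "AE \<omega> in M. (\<lambda>N. posterior_dim H a b \<alpha> s2 N (\<lambda>n. y n \<omega>) 0) \<longlonglongrightarrow> 0"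
proof -
  interpret prob_space M by fact
  interpret spike_model H a b s2 using assms by unfold_locales auto
  note distr = assms(8)
  define \<mu> where "\<mu> B = (\<integral>v. gauss_density 0 s2 v * capped_mean B v \<partial>lborel)" for B
  define w where "w N \<omega> k = joint_weight H a b \<alpha> s2 N (\<lambda>n. y n \<omega>) k" for N \<omega> k

  have one: "(\<integral>\<^sup>+ v. ennreal (gauss_density (0 :: real^'d) s2 v) \<partial>lborel) = 1"
  proof -
    have "prob_space (distr M lborel (y 1))"
      using distr[of 1] by (intro prob_space_distr) (auto simp: distributed_def)
    then have "emeasure (density lborel (\<lambda>v :: real^'d. ennreal (gauss_density 0 s2 v))) UNIV = 1"
      using prob_space.emeasure_space_1 distributed_distr_eq_density[OF distr[of 1]] by fastforce
    then show ?thesis by (simp add: emeasure_density)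
  qed

  \<comment> \<open>Caps run over positive integers: positivity gives the strong law a positive
    range, and countability gives one null set for all caps.\<close>
  have slln: "AE \<omega> in M. \<forall>B :: nat. (\<lambda>N. (\<Sum>n=1..N. capped_mean (Suc B) (y n \<omega>)) / N) \<longlonglongrightarrow> \<mu> (Suc B)"
  proof (subst AE_all_countable, intro allI)
    fix B :: nat
    show "AE \<omega> in M. (\<lambda>N. (\<Sum>n=1..N. capped_mean (Suc B) (y n \<omega>)) / N) \<longlonglongrightarrow> \<mu> (Suc B)"
    proof (rule strong_law_bounded[where B = "mass * Suc B"])
      show "indep_vars (\<lambda>_. borel) (\<lambda>n \<omega>. capped_mean (Suc B) (y n \<omega>)) {1..}"
        by (rule indep_vars_compose2[OF assms(7)]) auto
      show "expectation (\<lambda>\<omega>. capped_mean (Suc B) (y n \<omega>)) = \<mu> (Suc B)" if "1 \<le> n" for n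
        unfolding \<mu>_def by (rule distributed_integral[OF distr[OF that], symmetric]) auto
    qed (use mass_pos in \<open>auto intro!: capped_mean_bounds simp del: of_nat_Suc atLeastAtMost_iff\<close>)
  qed

  have "AE \<omega> in M. \<forall>K :: nat. eventually (\<lambda>N. w N \<omega> 0 * K \<le> w N \<omega> (Suc 0)) sequentially"
    using slln
  proof eventually_elim
    case (elim \<omega>)
    show ?case
    proof
      fix K :: nat
      \<comment> \<open>The order of choice is cutoff \<open>T\<close> from \<open>K\<close>, then
        cap \<open>B\<close> from \<open>T\<close>, then N. The spare 1 pays for the loss caused by
        capping.\<close>
      have "eventually (\<lambda>T. (K + 1) / \<alpha> + 1 \<le> mass * harm T) sequentially"
        using filterlim_tendsto_pos_mult_at_top[OF tendsto_const mass_pos harm_at_top]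
        by (auto simp: filterlim_at_top)
      then obtain T where T: "(K + 1) / \<alpha> + 1 \<le> mass * harm T"
        by (auto simp: eventually_sequentially)
      \<comment> \<open>Each of the \<open>T\<close> terms loses \<open>mass - \<mu> B\<close>, so
        the cap is taken large enough for the total loss to stay below 1.\<close>
      have "(\<lambda>B :: nat. T * (mass - \<mu> (Suc B))) \<longlonglongrightarrow> T * (mass - mass)"
        using LIMSEQ_Suc[OF tendsto_mean_capped_mean[OF one]] unfolding \<mu>_def
        by (intro tendsto_intros)
      then have "eventually (\<lambda>B :: nat. T * (mass - \<mu> (Suc B)) < 1) sequentially"
        by (rule order_tendstoD) simp
      then obtain B' :: nat where B': "T * (mass - \<mu> (Suc B')) < 1"
        by (auto simp: eventually_sequentially)
      define B where "B = real (Suc B')"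
      define A where "A N = (\<Sum>n=1..N. capped_mean B (y n \<omega>)) / N" for N
      define R where "R N = \<alpha> * (\<Sum>m=1..T. 1 / real m * (mass * (1 - real m - (real m)\<^sup>2 * B / real N) + real m * A N))" for N
      have A: "A \<longlonglongrightarrow> \<mu> B" using elim[rule_format, of B'] unfolding A_def B_def .
      have "R \<longlonglongrightarrow> \<alpha> * (\<Sum>m=1..T. 1 / real m * (mass * (1 - real m - 0) + real m * \<mu> B))"
        unfolding R_def
        by (intro tendsto_intros A tendsto_divide_0[OF tendsto_const] filterlim_at_top_imp_at_infinity
            filterlim_real_sequentially)
      \<comment> \<open>The part of the tangent line proportional to m cancels up to the capping
        loss, leaving the harmonic term.\<close>
      also have "(\<Sum>m=1..T. 1 / real m * (mass * (1 - real m - 0) + real m * \<mu> B))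
          = (\<Sum>m=1..T. mass * inverse (real m) - (mass - \<mu> B))"
        by (intro sum.cong refl) (auto simp: field_simps)
      also have "\<dots> = mass * harm T - T * (mass - \<mu> B)"
        by (simp add: sum_subtractf sum_distrib_left harm_def)
      finally have lim: "R \<longlonglongrightarrow> \<alpha> * (mass * harm T - T * (mass - \<mu> B))" .
      have "(K + 1) / \<alpha> < mass * harm T - T * (mass - \<mu> B)"
        using T B' by (simp add: B_def)
      then have "K < \<alpha> * (mass * harm T - T * (mass - \<mu> B))"
        using assms(1) by (simp add: pos_divide_less_eq mult.commute)
      with lim have "eventually (\<lambda>N. K < R N) sequentially" by (rule order_tendstoD(1))
      then show "eventually (\<lambda>N. w N \<omega> 0 * K \<le> w N \<omega> (Suc 0)) sequentially"
        using eventually_ge_at_top[of T]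
      proof eventually_elim
        case (elim N)
        have "w N \<omega> 0 * K \<le> w N \<omega> 0 * R N"
          using elim joint_weight_0_pos unfolding w_def by (intro mult_left_mono less_imp_le) auto
        also have "\<dots> \<le> w N \<omega> (Suc 0)"
          unfolding w_def R_def A_def using assms(1) elim
          by (intro joint_weight_1_ge) (auto simp: B_def)
        finally show ?case .
      qed
    qed
  qed
  then show ?thesis
  proof eventually_elim
    case (elim \<omega>)
    show ?case
    proof (rule tendstoI)
      fix e :: real assume "0 < e"
      then obtain k where k: "inverse (real (Suc k)) < e" using reals_Archimedean by blast
      from elim[rule_format, of "Suc k"]
      show "eventually (\<lambda>N. dist (posterior_dim H a b \<alpha> s2 N (\<lambda>n. y n \<omega>) 0) 0 < e) sequentially"
      proof eventually_elim
        case (elim N)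
        then have "posterior_dim H a b \<alpha> s2 N (\<lambda>n. y n \<omega>) 0 \<in> {0..1 / Suc k}"
          using assms(1) unfolding w_def by (intro posterior_dim_0_le) auto
        then show ?case using k by (auto simp: dist_real_def divide_inverse)
      qed
    qed
  qed
qed

end
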